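(* For all integers $m$ and $n$ with $2\le m\le n$, we have $\tau_4(P_m\square P_n)=14$.
   Context: $P_n$ is the path on $n$ vertices and $P_m\square P_n$ is the $m\times n$ grid graph, where $\square$ denotes the Cartesian product of graphs. $[k]=\{1,\dots,k\}$ and $\binom{[k]}{t}$ is the collection of all $t$-element subsets of $[k]$. $d(v,w)$ is the distance between $v$ and $w$. For a finite simple graph $G$ and positive integers $t,k$, a $t$-tone $k$-coloring of $G$ is a function $f:V(G)\to\binom{[k]}{t}$ such that $|f(v)\cap f(w)|<d(v,w)$ for all distinct $v,w\in V(G)$. The $t$-tone chromatic number $\tau_t(G)$ is the minimum $k$ such that $G$ has a $t$-tone $k$-coloring. *)

theory Defs
  imports "Graph_Theory.Pair_Digraph" "Graph_Theory.Shortest_Path" "HOL-Library.Ramsey"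
begin

text \<open>
  As in Graph_Theory, finite simple graphs are finite loop-free symmetric digraphs without
  parallel arcs (locale \<^locale>\<open>pair_graph\<close>): an undirected edge $\{u,v\}$ is the pair of arcs
  $(u,v)$, $(v,u)$.
\<close>

definition path_graph :: "nat \<Rightarrow> nat pair_pre_digraph" where
  "path_graph n = \<lparr> pverts = {1..n},
     parcs = {(i, j). i \<in> {1..n} \<and> j \<in> {1..n} \<and> (j = i + 1 \<or> i = j + 1)} \<rparr>"

definition cartesian_product ::
    "'a pair_pre_digraph \<Rightarrow> 'b pair_pre_digraph \<Rightarrow> ('a \<times> 'b) pair_pre_digraph"
    (infixl \<open>\<box>\<close> 70) where
  "G \<box> H = \<lparr> pverts = pverts G \<times> pverts H,
     parcs = {((u, v), (u', v')).
       (u = u' \<and> u \<in> pverts G \<and> (v, v') \<in> parcs H) \<or>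
       (v = v' \<and> v \<in> pverts H \<and> (u, u') \<in> parcs G)} \<rparr>"

lemma pair_graph_path_graph: "pair_graph (path_graph n)"
proof
  show "finite (parcs (path_graph n))"
    by (rule finite_subset[of _ "{1..n} \<times> {1..n}"]) (auto simp: path_graph_def)
qed (auto simp: path_graph_def symmetric_def sym_def)

lemma pair_graph_cartesian_product:
  assumes "pair_graph G" "pair_graph H"
  shows "pair_graph (G \<box> H)"
proof -
  interpret G: pair_graph G by fact
  interpret H: pair_graph H by fact
  show ?thesis
  proof
    show "finite (parcs (G \<box> H))"
      by (rule finite_subset[of _ "(pverts G \<times> pverts H) \<times> (pverts G \<times> pverts H)"])
        (auto simp: cartesian_product_def dest: G.wellformed' H.wellformed')
  qed (auto simp: cartesian_product_def symmetric_def sym_def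
      dest: G.wellformed' H.wellformed' G.arcs_symmetric H.arcs_symmetric
        G.no_loops' H.no_loops')
qed

text \<open>
  Graph distance: the least cost of a walk when every arc has weight 1. It is extended-real-valued
  so that vertices in different components are at distance \<open>\<infinity>\<close>.
\<close>

definition graph_dist :: "'a pair_pre_digraph \<Rightarrow> 'a \<Rightarrow> 'a \<Rightarrow> ereal" where
  "graph_dist G u v = wf_digraph.\<mu> (with_proj G) (\<lambda>_. 1) u v"

lemma (in pair_wf_digraph) graph_dist_eq:
  "graph_dist G u v = (INF p \<in> {p. awalk u p v}. ereal (length p))"
proof -
  have cost: "awalk_cost (\<lambda>_. 1) p = length p" for p
    by (induct p) auto
  show ?thesis
    unfolding graph_dist_def \<mu>_def by (simp add: cost)
qed

definition tone_coloring ::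
    "nat \<Rightarrow> nat \<Rightarrow> 'a pair_pre_digraph \<Rightarrow> ('a \<Rightarrow> nat set) \<Rightarrow> bool" where
  "tone_coloring t k G f \<longleftrightarrow>
     f \<in> pverts G \<rightarrow> nsets {1..k} t \<and>
     (\<forall>v \<in> pverts G. \<forall>w \<in> pverts G. v \<noteq> w \<longrightarrow>
        ereal (card (f v \<inter> f w)) < graph_dist G v w)"

definition tone_chromatic_number :: "nat \<Rightarrow> 'a pair_pre_digraph \<Rightarrow> nat" where
  "tone_chromatic_number t G = (LEAST k. 0 < k \<and> (\<exists>f. tone_coloring t k G f))"

end

theory Submission
  imports Defs
begin

text \<open>
  The lower bound already holds for the 4-cycle on \<open>{1,2} \<times> {1,2}\<close>, whose two diagonals are pairs
  of vertices at distance at most \<open>2\<close>. The two 4-sets on a diagonal share at most one colour, so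
  together they use at least seven; neighbours have disjoint sets, so the two diagonals use
  disjoint sets of colours, and at least \<open>7 + 7 = 14\<close> colours are needed.

  For the upper bound, the whole integer grid has an explicit colouring. Give \<open>(x, y)\<close> the four
  residues \<open>x + y mod 3\<close>, \<open>x - y mod 3\<close>, \<open>x + 2y mod 4\<close>, \<open>2x + y mod 4\<close>, each drawn from a block of
  colours of its own; the blocks have \<open>3 + 3 + 4 + 4 = 14\<close> colours in total. Two vertices that
  differ by \<open>(a, b)\<close> share as many colours as \<open>(a, b)\<close> satisfies of the four divisibility
  conditions \<open>3 dvd a + b\<close>, \<open>3 dvd a - b\<close>, \<open>4 dvd a + 2b\<close>, \<open>4 dvd 2a + b\<close>. That number is less than
  \<open>\<bar>a\<bar> + \<bar>b\<bar>\<close> unless \<open>a = b = 0\<close>: it is at most \<open>4\<close>, so only the finitely many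
  \<open>(a, b)\<close> with \<open>\<bar>a\<bar> + \<bar>b\<bar> \<le> 4\<close> have to be checked (lemma \<open>residue_agreements_less\<close>).
  The grid distance is at least the taxicab distance \<open>\<bar>a\<bar> + \<bar>b\<bar>\<close>, so it exceeds the number of
  shared colours as well.
\<close>

lemma graph_dist_le_length:
  assumes "pair_graph G" "pre_digraph.awalk (with_proj G) u p v"
  shows "graph_dist G u v \<le> ereal (length p)"
proof -
  interpret pair_graph G by fact
  show ?thesis
    unfolding graph_dist_eq using assms(2) by (intro INF_lower) simp
qed

lemma graph_dist_le_1:
  assumes "pair_graph G" "(u, v) \<in> parcs G"
  shows "graph_dist G u v \<le> 1"
proof -
  interpret pair_graph G by fact
  have "awalk u [(u, v)] v"
    using assms(2) by (auto simp: awalk_simps dest: wellformed')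
  from graph_dist_le_length[OF assms(1) this] show ?thesis by (simp add: one_ereal_def)
qed

lemma graph_dist_le_2:
  assumes "pair_graph G" "(u, v) \<in> parcs G" "(v, w) \<in> parcs G"
  shows "graph_dist G u w \<le> 2"
proof -
  interpret pair_graph G by fact
  have "awalk u [(u, v), (v, w)] w"
    using assms(2,3) by (auto simp: awalk_simps dest: wellformed')
  from graph_dist_le_length[OF assms(1) this] show ?thesis by simp
qed

text \<open>
  An arc changes one coordinate by one, so a
  walk cannot be shorter than the taxicab distance.
\<close>

lemma graph_dist_grid_ge:
  "ereal (of_int (\<bar>int (fst u) - int (fst v)\<bar> + \<bar>int (snd u) - int (snd v)\<bar>))
     \<le> graph_dist (path_graph m \<box> path_graph n) u v"
proof -
  let ?G = "path_graph m \<box> path_graph n"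
  interpret pair_graph ?G
    by (intro pair_graph_cartesian_product pair_graph_path_graph)
  have "\<bar>int (fst u) - int (fst v)\<bar> + \<bar>int (snd u) - int (snd v)\<bar> \<le> int (length p)"
    if "awalk u p v" for p
    using that
  proof (induction p arbitrary: u)
    case Nil
    then show ?case by (simp add: awalk_simps)
  next
    case (Cons e p)
    then have e: "e \<in> parcs ?G" "fst e = u" and "awalk (snd e) p v"
      by (auto simp: awalk_simps)
    have "\<bar>int (fst (snd e)) - int (fst v)\<bar> + \<bar>int (snd (snd e)) - int (snd v)\<bar> \<le> int (length p)"
      using Cons.IH \<open>awalk (snd e) p v\<close> by blast
    moreover have "\<bar>int (fst u) - int (fst (snd e))\<bar> + \<bar>int (snd u) - int (snd (snd e))\<bar> = 1"
      using e by (auto simp: cartesian_product_def path_graph_def)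
    ultimately show ?case by simp
  qed
  then show ?thesis
    unfolding graph_dist_eq by (intro INF_greatest) (simp add: of_int_le_iff[symmetric, where 'a = real])
qed

text \<open>
  The four 4-sets are those on a 4-cycle, in which \<open>A\<close>, \<open>C\<close> and \<open>B\<close>, \<open>D\<close> are opposite.
\<close>

lemma four_cycle_needs_14_colors:
  fixes k :: nat
  assumes sets: "A \<in> nsets {1..k} 4" "B \<in> nsets {1..k} 4" "C \<in> nsets {1..k} 4" "D \<in> nsets {1..k} 4"
    and opposite: "card (A \<inter> C) \<le> 1" "card (B \<inter> D) \<le> 1"
    and adjacent: "A \<inter> B = {}" "B \<inter> C = {}" "C \<inter> D = {}" "A \<inter> D = {}"
  shows "14 \<le> k"
proof -
  have fin: "finite A" "finite B" "finite C" "finite D"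
    and card: "card A = 4" "card B = 4" "card C = 4" "card D = 4"
    using sets by (auto simp: nsets_def)
  have "7 \<le> card (A \<union> C)" "7 \<le> card (B \<union> D)"
    using card_Un_Int[of A C] card_Un_Int[of B D] fin card opposite by auto
  moreover have "card ((A \<union> C) \<union> (B \<union> D)) = card (A \<union> C) + card (B \<union> D)"
    using adjacent fin by (intro card_Un_disjoint) auto
  moreover have "card ((A \<union> C) \<union> (B \<union> D)) \<le> card {1..k}"
    using sets by (intro card_mono) (auto simp: nsets_def)
  ultimately show ?thesis by simp
qed

lemma grid_tone_coloring_ge_14:
  assumes "2 \<le> m" "2 \<le> n" and "tone_coloring 4 k (path_graph m \<box> path_graph n) f"
  shows "14 \<le> k"
proof -
  let ?G = "path_graph m \<box> path_graph n"
  have G: "pair_graph ?G"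
    by (intro pair_graph_cartesian_product pair_graph_path_graph)
  have f: "f v \<in> nsets {1..k} 4" if "v \<in> pverts ?G" for v
    using assms(3) that by (auto simp: tone_coloring_def)
  have lt: "ereal (card (f v \<inter> f w)) < graph_dist ?G v w"
    if "v \<in> pverts ?G" "w \<in> pverts ?G" "v \<noteq> w" for v w
    using assms(3) that by (auto simp: tone_coloring_def)
  have V: "(1, 1) \<in> pverts ?G" "(1, 2) \<in> pverts ?G" "(2, 2) \<in> pverts ?G" "(2, 1) \<in> pverts ?G"
    using assms(1,2) by (auto simp: cartesian_product_def path_graph_def)
  have E: "((1, 1), (1, 2)) \<in> parcs ?G" "((1, 2), (2, 2)) \<in> parcs ?G"
    "((2, 2), (2, 1)) \<in> parcs ?G" "((1, 1), (2, 1)) \<in> parcs ?G"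
    using assms(1,2) by (auto simp: cartesian_product_def path_graph_def)
  have disj: "f v \<inter> f w = {}"
    if "(v, w) \<in> parcs ?G" "v \<in> pverts ?G" "w \<in> pverts ?G" "v \<noteq> w" for v w
  proof -
    have "ereal (card (f v \<inter> f w)) < 1"
      using lt[OF that(2,3,4)] graph_dist_le_1[OF G that(1)] by (rule less_le_trans)
    then have "card (f v \<inter> f w) = 0" by simp
    moreover have "finite (f v \<inter> f w)" using f[OF that(2)] by (simp add: nsets_def)
    ultimately show ?thesis by simp
  qed
  have share: "card (f u \<inter> f w) \<le> 1"
    if "(u, v) \<in> parcs ?G" "(v, w) \<in> parcs ?G" "u \<in> pverts ?G" "w \<in> pverts ?G" "u \<noteq> w"
    for u v w
  proof -
    have "ereal (card (f u \<inter> f w)) < 2"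
      using lt[OF that(3,4,5)] graph_dist_le_2[OF G that(1,2)] by (rule less_le_trans)
    then show ?thesis by simp
  qed
  have "((1, 2), (1, 1)) \<in> parcs ?G"
    using assms(1,2) by (auto simp: cartesian_product_def path_graph_def)
  from share[OF this E(4)] have "card (f (1, 2) \<inter> f (2, 1)) \<le> 1"
    using V by simp
  moreover have "card (f (1, 1) \<inter> f (2, 2)) \<le> 1"
    using share[OF E(1,2)] V by simp
  ultimately show ?thesis
    using four_cycle_needs_14_colors[OF f[OF V(1)] f[OF V(2)] f[OF V(3)] f[OF V(4)]]
      disj[OF E(1)] disj[OF E(2)] disj[OF E(3)] disj[OF E(4)] V by simp
qed

text \<open>
  The colouring of the upper bound, given on all pairs of natural numbers at once.
  The blocks of colours are \<open>{1..3}\<close>, \<open>{4..6}\<close>, \<open>{7..10}\<close> and \<open>{11..14}\<close>. The residue of \<open>x - y\<close>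
  modulo \<open>3\<close> is written as that of \<open>x + 2y\<close>, which avoids truncated subtraction.
\<close>

definition grid_coloring :: "nat \<times> nat \<Rightarrow> nat set" where
  "grid_coloring = (\<lambda>(x, y).
     {1 + (x + y) mod 3, 4 + (x + 2 * y) mod 3, 7 + (x + 2 * y) mod 4, 11 + (2 * x + y) mod 4})"

lemma color_blocks_in_nsets:
  fixes p q r s :: nat
  assumes "p < 3" "q < 3" "r < 4" "s < 4"
  shows "{1 + p, 4 + q, 7 + r, 11 + s} \<in> nsets {1..14} 4"
  using assms by (simp add: nsets_def card_insert_if)

lemma grid_coloring_in_nsets: "grid_coloring v \<in> nsets {1..14} 4"
  by (cases v) (simp only: grid_coloring_def prod.case, intro color_blocks_in_nsets, simp_all)

lemma residue_agreements_less:
  fixes a b :: int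
  assumes "a \<noteq> 0 \<or> b \<noteq> 0"
  shows "of_bool (3 dvd a + b) + of_bool (3 dvd a + 2 * b) + of_bool (4 dvd a + 2 * b)
           + of_bool (4 dvd 2 * a + b) < \<bar>a\<bar> + \<bar>b\<bar>"
proof (cases "\<bar>a\<bar> + \<bar>b\<bar> \<le> 4")
  case False
  then show ?thesis by (auto simp: of_bool_def)
next
  case True
  let ?N = "{-4, -3, -2, -1, 0, 1, 2, 3, 4 :: int}"
  have "\<forall>a \<in> ?N. \<forall>b \<in> ?N. \<bar>a\<bar> + \<bar>b\<bar> \<le> 4 \<and> (a \<noteq> 0 \<or> b \<noteq> 0) \<longrightarrow>
      of_bool (3 dvd a + b) + of_bool (3 dvd a + 2 * b) + of_bool (4 dvd a + 2 * b)
        + of_bool (4 dvd 2 * a + b) < \<bar>a\<bar> + \<bar>b :: int\<bar>"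
    by simp
  moreover from True have "a \<in> ?N" "b \<in> ?N" by (auto; presburger)+
  ultimately show ?thesis using assms True by blast
qed

lemma card_Int_color_blocks_le:
  fixes p q r s p' q' r' s' :: nat
  assumes "p < 3" "q < 3" "r < 4" "s < 4" and "p' < 3" "q' < 3" "r' < 4" "s' < 4"
  shows "card ({1 + p, 4 + q, 7 + r, 11 + s} \<inter> {1 + p', 4 + q', 7 + r', 11 + s'})
           \<le> of_bool (p = p') + of_bool (q = q') + of_bool (r = r') + of_bool (s = s')"
proof -
  \<comment> \<open>Colours from different blocks never coincide.\<close>
  have "{1 + p, 4 + q, 7 + r, 11 + s} \<inter> {1 + p', 4 + q', 7 + r', 11 + s'} =
      ({1 + p} \<inter> {1 + p'}) \<union> ({4 + q} \<inter> {4 + q'}) \<union> ({7 + r} \<inter> {7 + r'}) \<union> ({11 + s} \<inter> {11 + s'})"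
    using assms by (intro equalityI subsetI; simp only: Int_iff Un_iff insert_iff empty_iff; linarith)
  also have "card \<dots> \<le> card ({1 + p} \<inter> {1 + p'}) + card ({4 + q} \<inter> {4 + q'})
      + card ({7 + r} \<inter> {7 + r'}) + card ({11 + s} \<inter> {11 + s'})"
    by (meson add_le_mono card_Un_le le_refl le_trans)
  also have "\<dots> = of_bool (p = p') + of_bool (q = q') + of_bool (r = r') + of_bool (s = s')"
    by (simp add: of_bool_def)
  finally show ?thesis .
qed

lemma card_grid_coloring_Int_less:
  assumes "v \<noteq> w"
  shows "int (card (grid_coloring v \<inter> grid_coloring w))
           < \<bar>int (fst v) - int (fst w)\<bar> + \<bar>int (snd v) - int (snd w)\<bar>"
proof -
  obtain x y x' y' where vw: "v = (x, y)" "w = (x', y')" by (metis surj_pair)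
  define a b where "a = int x - int x'" and "b = int y - int y'"
  have agree: "s mod k = t mod k \<longleftrightarrow> c dvd d" if "int s - int t = d" "int k = c"
    for s t k :: nat and c d :: int
    using that by (metis mod_eq_dvd_iff of_nat_eq_iff zmod_int)
  have "(x + y) mod 3 = (x' + y') mod 3 \<longleftrightarrow> 3 dvd a + b"
    "(x + 2 * y) mod 3 = (x' + 2 * y') mod 3 \<longleftrightarrow> 3 dvd a + 2 * b"
    "(x + 2 * y) mod 4 = (x' + 2 * y') mod 4 \<longleftrightarrow> 4 dvd a + 2 * b"
    "(2 * x + y) mod 4 = (2 * x' + y') mod 4 \<longleftrightarrow> 4 dvd 2 * a + b"
    by (rule agree; simp add: a_def b_def)+
  then have "card (grid_coloring v \<inter> grid_coloring w) \<le>
      of_bool (3 dvd a + b) + of_bool (3 dvd a + 2 * b) + of_bool (4 dvd a + 2 * b)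
        + of_bool (4 dvd 2 * a + b)"
    using card_Int_color_blocks_le[of "(x + y) mod 3" "(x + 2 * y) mod 3" "(x + 2 * y) mod 4"
        "(2 * x + y) mod 4" "(x' + y') mod 3" "(x' + 2 * y') mod 3" "(x' + 2 * y') mod 4"
        "(2 * x' + y') mod 4"]
    by (simp add: vw grid_coloring_def)
  then have "int (card (grid_coloring v \<inter> grid_coloring w)) \<le>
      of_bool (3 dvd a + b) + of_bool (3 dvd a + 2 * b) + of_bool (4 dvd a + 2 * b)
        + of_bool (4 dvd 2 * a + b)"
    by (simp only: of_nat_le_iff[symmetric, where 'a = int] of_nat_add of_nat_of_bool)
  also have "\<dots> < \<bar>a\<bar> + \<bar>b\<bar>"
    using assms by (intro residue_agreements_less) (auto simp: vw a_def b_def)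
  finally show ?thesis by (simp add: vw a_def b_def)
qed

lemma tone_coloring_grid_coloring:
  "tone_coloring 4 14 (path_graph m \<box> path_graph n) grid_coloring"
  unfolding tone_coloring_def
proof (intro conjI ballI impI)
  show "grid_coloring \<in> pverts (path_graph m \<box> path_graph n) \<rightarrow> nsets {1..14} 4"
    using grid_coloring_in_nsets by blast
next
  fix v w :: "nat \<times> nat"
  assume "v \<noteq> w"
  have "real (card (grid_coloring v \<inter> grid_coloring w))
      < of_int (\<bar>int (fst v) - int (fst w)\<bar> + \<bar>int (snd v) - int (snd w)\<bar>)"
    using card_grid_coloring_Int_less[OF \<open>v \<noteq> w\<close>] by linarith
  then show "ereal (card (grid_coloring v \<inter> grid_coloring w))
      < graph_dist (path_graph m \<box> path_graph n) v w"
    using graph_dist_grid_ge[of v w m n] by (metis less_ereal.simps(1) less_le_trans)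
qed

theorem theorem5p2:
  fixes m n :: nat
  assumes "2 \<le> m" and "m \<le> n"
  shows "tone_chromatic_number 4 (path_graph m \<box> path_graph n) = 14"
  unfolding tone_chromatic_number_def
proof (rule Least_equality)
  show "0 < (14 :: nat) \<and> (\<exists>f. tone_coloring 4 14 (path_graph m \<box> path_graph n) f)"
    using tone_coloring_grid_coloring by auto
next
  fix k
  assume "0 < k \<and> (\<exists>f. tone_coloring 4 k (path_graph m \<box> path_graph n) f)"
  then show "14 \<le> k"
    using grid_tone_coloring_ge_14[of m n k] assms by auto
qed

end
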